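(* If a focused hypersequent $[p]G$ is derivable in $\mathbf{GA_t}$, then $\models_{\mathbf{A}} G$.
   Context: Formulas are built from propositional variables and $t$ using $+,\to,\land,\lor,\lnot$. A sequent (component) is a pair of finite multisets $\Gamma\vdash\Delta$; a hypersequent a finite multiset of components. $\models_{\mathbf{A}}G$ means: for every valuation into $\mathbb{Q}$ ($t=0$, $+$ addition, $\lnot$ negation, $A\to B$ valued $v(B)-v(A)$, $\land=\min$, $\lor=\max$) some component $\Gamma_i\vdash\Delta_i$ of $G$ has $\sum v(\Gamma_i)\le\sum v(\Delta_i)$ (empty sum $0$). A focused hypersequent $[q]G$ is a hypersequent $G$ together with a propositional variable $q$. $m\Gamma$ is $m$ copies of $\Gamma$, $np$ is $n$ copies of $p$; "atomic" means consisting of propositional variables. Calculus $\mathbf{GA_t}$ (same focus $[q]$ in premises and conclusion unless stated; each logical rule carries a side hypersequent $[q]G\mid$): axioms $[q]A\vdash A$ and $[q]\vdash$; (EW) from $[q]G\mid\Gamma\vdash\Delta$ infer $[q]G\mid\Gamma\vdash\Delta\mid\Gamma'\vdash\Delta'$; (M) from $[q]G\mid\Gamma_1\vdash\Delta_1$ and $[q]G\mid\Gamma_2\vdash\Delta_2$ infer $[q]G\mid\Gamma_1,\Gamma_2\vdash\Delta_1,\Delta_2$; logical rules $(t,l)$ $\Gamma\vdash\Delta/\Gamma,t\vdash\Delta$; $(t,r)$ $\Gamma\vdash\Delta/\Gamma\vdash t,\Delta$; $(\lnot,l)$ $\Gamma\vdash A,\Delta/\Gamma,\lnot A\vdash\Delta$;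 $(\lnot,r)$ $\Gamma,A\vdash\Delta/\Gamma\vdash\lnot A,\Delta$; $(\to,l)$ $\Gamma,B\vdash A,\Delta/\Gamma,A\to B\vdash\Delta$; $(\to,r)$ $\Gamma,A\vdash B,\Delta/\Gamma\vdash A\to B,\Delta$; $(+,l)$ $\Gamma,A,B\vdash\Delta/\Gamma,A+B\vdash\Delta$; $(+,r)$ $\Gamma\vdash A,B,\Delta/\Gamma\vdash A+B,\Delta$; $(\land,l)$ $\Gamma,A\vdash\Delta\mid\Gamma,B\vdash\Delta/\Gamma,A\land B\vdash\Delta$; $(\land,r)$ premises $\Gamma\vdash A,\Delta$ and $\Gamma\vdash B,\Delta$, conclusion $\Gamma\vdash A\land B,\Delta$; $(\lor,l)$ premises $\Gamma,A\vdash\Delta$ and $\Gamma,B\vdash\Delta$, conclusion $\Gamma,A\lor B\vdash\Delta$; $(\lor,r)$ $\Gamma\vdash A,\Delta\mid\Gamma\vdash B,\Delta/\Gamma\vdash A\lor B,\Delta$; (shift) from $[q]G$ infer $[p]G$ provided $q$ occurs in $G$ and $p$ does not; (S') from $[p]G\mid m\Gamma_1,n\Gamma_2\vdash m\Delta_1,n\Delta_2\mid S$ infer $[p]G\mid\Gamma_1,np\vdash\Delta_1\mid\Gamma_2\vdash\Delta_2,mp$, provided $\Gamma_1,\Gamma_2,\Delta_1,\Delta_2$ atomic, $n,m>0$, $p$ not in $\Gamma_1,\Delta_1,\Gamma_2,\Delta_2$, and $S$ is $\Gamma_1,np\vdash\Delta_1$ or $\Gamma_2\vdash\Delta_2,mp$.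 *)

theory Defs
  imports Complex_Main "HOL-Library.Multiset"
begin

datatype (vars: 'v) fm =
    Var 'v
  | TConst  ("\<^bold>t")
  | Plus "'v fm" "'v fm"  (infixl "\<^bold>+" 75)
  | Imp "'v fm" "'v fm"  (infixr "\<^bold>\<rightarrow>" 65)
  | Conj "'v fm" "'v fm"  (infixr "\<^bold>\<and>" 72)
  | Disj "'v fm" "'v fm"  (infixr "\<^bold>\<or>" 70)
  | Neg "'v fm"  ("\<^bold>\<not> _" [80] 80)

datatype 'v sequent =
  Seq (ante: "'v fm multiset") (succ: "'v fm multiset")  (infix "\<turnstile>" 55)

type_synonym 'v hypersequent = "'v sequent multiset"

primrec eval :: "('v \<Rightarrow> rat) \<Rightarrow> 'v fm \<Rightarrow> rat" where
  "eval v (Var x) = v x"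
| "eval v \<^bold>t = 0"
| "eval v (A \<^bold>+ B) = eval v A + eval v B"
| "eval v (A \<^bold>\<rightarrow> B) = eval v B - eval v A"
| "eval v (A \<^bold>\<and> B) = min (eval v A) (eval v B)"
| "eval v (A \<^bold>\<or> B) = max (eval v A) (eval v B)"
| "eval v (\<^bold>\<not> A) = - eval v A"

definition seq_true :: "('v \<Rightarrow> rat) \<Rightarrow> 'v sequent \<Rightarrow> bool" where
  "seq_true v s \<longleftrightarrow> (\<Sum>A\<in>#ante s. eval v A) \<le> (\<Sum>A\<in>#succ s. eval v A)"

definition valid_A :: "'v hypersequent \<Rightarrow> bool"  ("\<Turnstile>\<^sub>A _" [50] 50) where
  "\<Turnstile>\<^sub>A G \<longleftrightarrow> (\<forall>v. \<exists>s\<in>#G. seq_true v s)"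

definition atomic_mset :: "'v fm multiset \<Rightarrow> bool" where
  "atomic_mset \<Gamma> \<longleftrightarrow> (\<forall>A\<in>#\<Gamma>. \<exists>x. A = Var x)"

definition mset_vars :: "'v fm multiset \<Rightarrow> 'v set" where
  "mset_vars \<Gamma> = (\<Union>A\<in>set_mset \<Gamma>. vars A)"

definition hyp_vars :: "'v hypersequent \<Rightarrow> 'v set" where
  "hyp_vars G = (\<Union>s\<in>set_mset G. mset_vars (ante s) \<union> mset_vars (succ s))"

text \<open>
  \<open>GAt q G\<close> is derivability of the focused hypersequent \<open>[q]G\<close>. The side hypersequent
  \<open>G\<close> of a rule may be empty. In \<open>S'\<close> the eliminated variable is the focus.
\<close>

inductive GAt :: "'v \<Rightarrow> 'v hypersequent \<Rightarrow> bool" where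
  Ax: "GAt q {# {#A#} \<turnstile> {#A#} #}"
| Ax_empty: "GAt q {# {#} \<turnstile> {#} #}"
| EW: "GAt q (add_mset (\<Gamma> \<turnstile> \<Delta>) G) \<Longrightarrow>
    GAt q (add_mset (\<Gamma> \<turnstile> \<Delta>) (add_mset (\<Gamma>' \<turnstile> \<Delta>') G))"
| M: "GAt q (add_mset (\<Gamma>\<^sub>1 \<turnstile> \<Delta>\<^sub>1) G) \<Longrightarrow> GAt q (add_mset (\<Gamma>\<^sub>2 \<turnstile> \<Delta>\<^sub>2) G) \<Longrightarrow>
    GAt q (add_mset (\<Gamma>\<^sub>1 + \<Gamma>\<^sub>2 \<turnstile> \<Delta>\<^sub>1 + \<Delta>\<^sub>2) G)"
| t_l: "GAt q (add_mset (\<Gamma> \<turnstile> \<Delta>) G) \<Longrightarrow>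
    GAt q (add_mset (add_mset \<^bold>t \<Gamma> \<turnstile> \<Delta>) G)"
| t_r: "GAt q (add_mset (\<Gamma> \<turnstile> \<Delta>) G) \<Longrightarrow>
    GAt q (add_mset (\<Gamma> \<turnstile> add_mset \<^bold>t \<Delta>) G)"
| Neg_l: "GAt q (add_mset (\<Gamma> \<turnstile> add_mset A \<Delta>) G) \<Longrightarrow>
    GAt q (add_mset (add_mset (\<^bold>\<not> A) \<Gamma> \<turnstile> \<Delta>) G)"
| Neg_r: "GAt q (add_mset (add_mset A \<Gamma> \<turnstile> \<Delta>) G) \<Longrightarrow>
    GAt q (add_mset (\<Gamma> \<turnstile> add_mset (\<^bold>\<not> A) \<Delta>) G)"
| Imp_l: "GAt q (add_mset (add_mset B \<Gamma> \<turnstile> add_mset A \<Delta>) G) \<Longrightarrow>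
    GAt q (add_mset (add_mset (A \<^bold>\<rightarrow> B) \<Gamma> \<turnstile> \<Delta>) G)"
| Imp_r: "GAt q (add_mset (add_mset A \<Gamma> \<turnstile> add_mset B \<Delta>) G) \<Longrightarrow>
    GAt q (add_mset (\<Gamma> \<turnstile> add_mset (A \<^bold>\<rightarrow> B) \<Delta>) G)"
| Plus_l: "GAt q (add_mset (add_mset A (add_mset B \<Gamma>) \<turnstile> \<Delta>) G) \<Longrightarrow>
    GAt q (add_mset (add_mset (A \<^bold>+ B) \<Gamma> \<turnstile> \<Delta>) G)"
| Plus_r: "GAt q (add_mset (\<Gamma> \<turnstile> add_mset A (add_mset B \<Delta>)) G) \<Longrightarrow>
    GAt q (add_mset (\<Gamma> \<turnstile> add_mset (A \<^bold>+ B) \<Delta>) G)"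
| Conj_l: "GAt q (add_mset (add_mset A \<Gamma> \<turnstile> \<Delta>) (add_mset (add_mset B \<Gamma> \<turnstile> \<Delta>) G)) \<Longrightarrow>
    GAt q (add_mset (add_mset (A \<^bold>\<and> B) \<Gamma> \<turnstile> \<Delta>) G)"
| Conj_r: "GAt q (add_mset (\<Gamma> \<turnstile> add_mset A \<Delta>) G) \<Longrightarrow> GAt q (add_mset (\<Gamma> \<turnstile> add_mset B \<Delta>) G) \<Longrightarrow>
    GAt q (add_mset (\<Gamma> \<turnstile> add_mset (A \<^bold>\<and> B) \<Delta>) G)"
| Disj_l: "GAt q (add_mset (add_mset A \<Gamma> \<turnstile> \<Delta>) G) \<Longrightarrow> GAt q (add_mset (add_mset B \<Gamma> \<turnstile> \<Delta>) G) \<Longrightarrow>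
    GAt q (add_mset (add_mset (A \<^bold>\<or> B) \<Gamma> \<turnstile> \<Delta>) G)"
| Disj_r: "GAt q (add_mset (\<Gamma> \<turnstile> add_mset A \<Delta>) (add_mset (\<Gamma> \<turnstile> add_mset B \<Delta>) G)) \<Longrightarrow>
    GAt q (add_mset (\<Gamma> \<turnstile> add_mset (A \<^bold>\<or> B) \<Delta>) G)"
| shift: "GAt q G \<Longrightarrow> q \<in> hyp_vars G \<Longrightarrow> p \<notin> hyp_vars G \<Longrightarrow> GAt p G"
| S': "GAt p (add_mset (repeat_mset m \<Gamma>\<^sub>1 + repeat_mset n \<Gamma>\<^sub>2 \<turnstile> repeat_mset m \<Delta>\<^sub>1 + repeat_mset n \<Delta>\<^sub>2)
           (add_mset S G)) \<Longrightarrow>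
    atomic_mset \<Gamma>\<^sub>1 \<Longrightarrow> atomic_mset \<Gamma>\<^sub>2 \<Longrightarrow> atomic_mset \<Delta>\<^sub>1 \<Longrightarrow> atomic_mset \<Delta>\<^sub>2 \<Longrightarrow>
    n > 0 \<Longrightarrow> m > 0 \<Longrightarrow>
    p \<notin> mset_vars \<Gamma>\<^sub>1 \<union> mset_vars \<Delta>\<^sub>1 \<union> mset_vars \<Gamma>\<^sub>2 \<union> mset_vars \<Delta>\<^sub>2 \<Longrightarrow>
    S = (\<Gamma>\<^sub>1 + replicate_mset n (Var p) \<turnstile> \<Delta>\<^sub>1) \<or> S = (\<Gamma>\<^sub>2 \<turnstile> \<Delta>\<^sub>2 + replicate_mset m (Var p)) \<Longrightarrow>
    GAt p (add_mset (\<Gamma>\<^sub>1 + replicate_mset n (Var p) \<turnstile> \<Delta>\<^sub>1)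
           (add_mset (\<Gamma>\<^sub>2 \<turnstile> \<Delta>\<^sub>2 + replicate_mset m (Var p)) G))"

end

(* Every rule is sound pointwise: a valuation satisfying the premises satisfies the conclusion.
   For (S'), if both displayed components of the conclusion failed, then m times the first plus
   n times the second would refute the combined component of the premise, since the two
   occurrences of (m n) p cancel. *)
theory Submission
  imports Defs
begin

lemma sum_mset_repeat:
  fixes f :: "'a \<Rightarrow> 'b::comm_semiring_1"
  shows "(\<Sum>x\<in>#repeat_mset n M. f x) = of_nat n * (\<Sum>x\<in>#M. f x)"
  by (induction n) (simp_all add: algebra_simps)

lemma seq_true_Seq [simp]:
  "seq_true v (\<Gamma> \<turnstile> \<Delta>) \<longleftrightarrow> (\<Sum>A\<in>#\<Gamma>. eval v A) \<le> (\<Sum>A\<in>#\<Delta>. eval v A)"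
  by (simp add: seq_true_def)

lemma seq_true_eliminate_var:
  assumes combined: "seq_true v (repeat_mset m \<Gamma>\<^sub>1 + repeat_mset n \<Gamma>\<^sub>2 \<turnstile>
      repeat_mset m \<Delta>\<^sub>1 + repeat_mset n \<Delta>\<^sub>2)"
    and "n > 0" "m > 0"
  shows "seq_true v (\<Gamma>\<^sub>1 + replicate_mset n (Var p) \<turnstile> \<Delta>\<^sub>1) \<or>
    seq_true v (\<Gamma>\<^sub>2 \<turnstile> \<Delta>\<^sub>2 + replicate_mset m (Var p))"
proof (rule ccontr)
  let ?s = "\<lambda>M. \<Sum>A\<in>#M. eval v A"
  assume "\<not> ?thesis"
  then have "?s \<Delta>\<^sub>1 < ?s \<Gamma>\<^sub>1 + of_nat n * v p" "?s \<Delta>\<^sub>2 + of_nat m * v p < ?s \<Gamma>\<^sub>2"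
    by (simp_all add: not_le)
  \<comment> \<open>Positivity of \<open>m\<close> and \<open>n\<close> keeps both inequalities
    strict.\<close>
  then have "of_nat m * ?s \<Delta>\<^sub>1 < of_nat m * (?s \<Gamma>\<^sub>1 + of_nat n * v p)"
    "of_nat n * (?s \<Delta>\<^sub>2 + of_nat m * v p) < of_nat n * ?s \<Gamma>\<^sub>2"
    using assms(2,3) by (simp_all add: mult_strict_left_mono)
  then show False
    using combined by (simp add: sum_mset_repeat algebra_simps)
qed

text \<open>No rule changes the valuation, so one fixed \<open>v\<close> serves the whole induction;
  \<open>shift\<close> changes only the focus, on which truth does not depend.\<close>

lemma GAt_sound:
  assumes "GAt p G"
  shows "\<exists>s\<in>#G. seq_true v s"
  using assms
proof (induction rule: GAt.induct)
  case (S' p m \<Gamma>\<^sub>1 n \<Gamma>\<^sub>2 \<Delta>\<^sub>1 \<Delta>\<^sub>2 S G)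
  \<comment> \<open>If \<open>S\<close> is the true component, it already occurs in the conclusion.
    \<open>seq_true\<close> stays folded so that the disjuncts of the lemma match
    components.\<close>
  then show ?case
    using seq_true_eliminate_var[of v m \<Gamma>\<^sub>1 n \<Gamma>\<^sub>2 \<Delta>\<^sub>1 \<Delta>\<^sub>2 p] by (auto simp del: seq_true_Seq)
\<comment> \<open>\<open>add_mono\<close> handles \<open>M\<close>; the lattice rules become case
  splits on \<open>min\<close> and \<open>max\<close>.\<close>
qed (auto simp: min_def max_def algebra_simps intro: add_mono split: if_splits)

theorem mainTheorem9:
  fixes p :: 'v and G :: "'v hypersequent"
  assumes "GAt p G"
  shows "\<Turnstile>\<^sub>A G"
  unfolding valid_A_def using GAt_sound[OF assms] by blast

end
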